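(* Let $G=(V,E)$ be a graph on the vertex set $V=\{x_1,\ldots,x_n\}$, let $\mathbb{K}$ be a field, let $R=\mathbb{K}[x_1,\ldots,x_n]$, and let $I(G)=\langle x_ix_j : \{x_i,x_j\}\in E\rangle\subseteq R$ be the edge ideal of $G$. Let $(c_1,\ldots,c_n)$ be a vector of positive integers. Then $G$ is a levelable graph with respect to the weight function $(c_1,\ldots,c_n)$ if and only if $$R/(I(G)+\langle x_1^{c_1+1},\ldots,x_n^{c_n+1}\rangle)$$ is a level graded artinian ring.
   Context: All graphs are finite and simple. A subset $W$ of the vertex set is independent if it contains no edge; it is a maximal independent set if no independent set strictly contains it. Let $\mathrm{MaxInd}(G)$ be the set of maximal independent sets of $G$. $G$ is levelable with respect to the weight function $(c_1,\ldots,c_n)$ of positive integers if there is a constant $c$ with $\sum_{x_i\in W}c_i=c$ for all $W\in\mathrm{MaxInd}(G)$. A standard graded algebra $A=\mathbb{K}[x_1,\ldots,x_n]/I$ ($I$ a homogeneous ideal) is artinian if its Krull dimension is $0$; then $A=A_0\oplus A_1\oplus\cdots\oplus A_e$ with $A_e\neq 0$, where $A_i$ is the space of homogeneous elements of degree $i$. The socle is $\mathrm{soc}(A)=\{a\in A : a\overline{x}_i=0 \text{ for } i=1,\ldots,n\}$, a homogeneous ideal, and the socle-vector is $s(A)=(s_0,\ldots,s_e)$ with $s_i=\dim_{\mathbb{K}}\mathrm{soc}(A)_i$. The graded artinian algebra $A$ is level if $s(A)=(0,\ldots,0,s_e)$ with $s_e>0$. *)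

theory Defs
  imports
    "HOL-Algebra.Embedded_Algebras"
    "HOL-Algebra.QuotRing"
    "HOL-Library.Poly_Mapping"
    "HOL-Library.Extended_Real"
begin

section \<open>Levelable graphs\<close>

definition simple_graph :: "'v set \<Rightarrow> 'v set set \<Rightarrow> bool" where
  "simple_graph V E \<longleftrightarrow> finite V \<and> (\<forall>e\<in>E. e \<subseteq> V \<and> card e = 2)"

definition independent_set :: "'v set \<Rightarrow> 'v set set \<Rightarrow> 'v set \<Rightarrow> bool" where
  "independent_set V E W \<longleftrightarrow> W \<subseteq> V \<and> (\<forall>e\<in>E. \<not> e \<subseteq> W)"

definition MaxInd :: "'v set \<Rightarrow> 'v set set \<Rightarrow> 'v set set" where
  "MaxInd V E =
    {W. independent_set V E W \<and> (\<forall>W'. independent_set V E W' \<longrightarrow> \<not> W \<subset> W')}"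

text \<open>Positivity of the weights is left to the user of this predicate.\<close>

definition levelable :: "'v set \<Rightarrow> 'v set set \<Rightarrow> ('v \<Rightarrow> nat) \<Rightarrow> bool" where
  "levelable V E c \<longleftrightarrow> (\<exists>k. \<forall>W\<in>MaxInd V E. sum c W = k)"

section \<open>Polynomial rings\<close>

text \<open>
  A monomial is a finitely supported exponent vector, a polynomial a finitely supported
  coefficient function on monomials.  The type \<open>('v, 'k) mpoly\<close> allows every element of
  \<open>'v\<close> as an indeterminate; the ring with indeterminates \<open>V\<close> is cut out by its carrier.
\<close>

type_synonym ('v, 'k) mpoly = "('v \<Rightarrow>\<^sub>0 nat) \<Rightarrow>\<^sub>0 'k"

definition mpoly_ring :: "'v set \<Rightarrow> ('v, 'k::field) mpoly ring" where
  "mpoly_ring V =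
    \<lparr>carrier = {p. \<forall>m\<in>Poly_Mapping.keys p. Poly_Mapping.keys m \<subseteq> V},
     mult = (*), one = 1, zero = 0, add = (+)\<rparr>"

definition var :: "'v \<Rightarrow> ('v, 'k::field) mpoly" where
  "var x = Poly_Mapping.single (Poly_Mapping.single x 1) 1"

definition const :: "'k::field \<Rightarrow> ('v, 'k) mpoly" where
  "const a = Poly_Mapping.single 0 a"

definition mon_degree :: "('v \<Rightarrow>\<^sub>0 nat) \<Rightarrow> nat" where
  "mon_degree m = (\<Sum>x\<in>Poly_Mapping.keys m. Poly_Mapping.lookup m x)"

definition homogeneous :: "'v set \<Rightarrow> nat \<Rightarrow> ('v, 'k::field) mpoly set" where
  "homogeneous V d =
    {p \<in> carrier (mpoly_ring V). \<forall>m\<in>Poly_Mapping.keys p. mon_degree m = d}"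

definition homogeneous_ideal :: "'v set \<Rightarrow> ('v, 'k::field) mpoly set \<Rightarrow> bool" where
  "homogeneous_ideal V I \<longleftrightarrow>
    (\<exists>S. S \<subseteq> (\<Union>d. homogeneous V d) \<and> I = Idl\<^bsub>mpoly_ring V\<^esub> S)"

definition edge_ideal :: "'v set \<Rightarrow> 'v set set \<Rightarrow> ('v, 'k::field) mpoly set" where
  "edge_ideal V E = Idl\<^bsub>mpoly_ring V\<^esub> {var x * var y | x y. {x, y} \<in> E}"

section \<open>Krull dimension\<close>

text \<open>
  \<open>P 0 \<subset> \<dots> \<subset> P k\<close> is a chain of length \<open>k\<close>.  The supremum is taken in the extended reals,
  so the zero ring, which has no prime ideals, has Krull dimension \<open>-\<infinity>\<close> rather than \<open>0\<close>.
\<close>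

definition prime_chain :: "('a, 'b) ring_scheme \<Rightarrow> (nat \<Rightarrow> 'a set) \<Rightarrow> nat \<Rightarrow> bool" where
  "prime_chain A P k \<longleftrightarrow>
    (\<forall>i\<le>k. primeideal (P i) A) \<and> (\<forall>i<k. P i \<subset> P (Suc i))"

definition krull_dim :: "('a, 'b) ring_scheme \<Rightarrow> ereal" where
  "krull_dim A = Sup {ereal (real k) | k. \<exists>P. prime_chain A P k}"

section \<open>Standard graded algebras\<close>

text \<open>
  A standard graded algebra is presented by the set \<open>V\<close> of indeterminates and the ideal \<open>I\<close>;
  its elements are the cosets of \<open>I\<close>.
\<close>

definition quotient_algebra :: "'v set \<Rightarrow> ('v, 'k::field) mpoly set \<Rightarrow> ('v, 'k) mpoly set ring" where
  "quotient_algebra V I = mpoly_ring V Quot I"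

definition residue_class :: "'v set \<Rightarrow> ('v, 'k::field) mpoly set \<Rightarrow> ('v, 'k) mpoly \<Rightarrow> ('v, 'k) mpoly set" where
  "residue_class V I p = I +>\<^bsub>mpoly_ring V\<^esub> p"

text \<open>The copy of the ground field \<open>'k\<close> in \<open>quotient_algebra V I\<close>.\<close>

definition scalars :: "'v set \<Rightarrow> ('v, 'k::field) mpoly set \<Rightarrow> ('v, 'k) mpoly set set" where
  "scalars V I = range (\<lambda>a. residue_class V I (const a))"

definition graded_part :: "'v set \<Rightarrow> ('v, 'k::field) mpoly set \<Rightarrow> nat \<Rightarrow> ('v, 'k) mpoly set set" where
  "graded_part V I d = residue_class V I ` homogeneous V d"

definition socle :: "'v set \<Rightarrow> ('v, 'k::field) mpoly set \<Rightarrow> ('v, 'k) mpoly set set" where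
  "socle V I = {a \<in> carrier (quotient_algebra V I). \<forall>x\<in>V.
      a \<otimes>\<^bsub>quotient_algebra V I\<^esub> residue_class V I (var x) = \<zero>\<^bsub>quotient_algebra V I\<^esub>}"

definition socle_vector :: "'v set \<Rightarrow> ('v, 'k::field) mpoly set \<Rightarrow> nat \<Rightarrow> nat" where
  "socle_vector V I d =
    (ring.dim (quotient_algebra V I) over scalars V I) (socle V I \<inter> graded_part V I d)"

definition graded_artinian :: "'v set \<Rightarrow> ('v, 'k::field) mpoly set \<Rightarrow> bool" where
  "graded_artinian V I \<longleftrightarrow>
    homogeneous_ideal V I \<and> krull_dim (quotient_algebra V I) = 0"

text \<open>The number \<open>e\<close> below is unique: it is the largest degree with a nonzero graded part.\<close>

definition level_graded_artinian :: "'v set \<Rightarrow> ('v, 'k::field) mpoly set \<Rightarrow> bool" where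
  "level_graded_artinian V I \<longleftrightarrow> graded_artinian V I \<and>
    (\<exists>e. graded_part V I e \<noteq> {\<zero>\<^bsub>quotient_algebra V I\<^esub>} \<and>
         (\<forall>d>e. graded_part V I d = {\<zero>\<^bsub>quotient_algebra V I\<^esub>}) \<and>
         (\<forall>d<e. socle_vector V I d = 0) \<and> socle_vector V I e > 0)"

end

theory Submission
  imports Defs
begin

text \<open>
  The ideal of the theorem is spanned by the monomials it contains, so a residue class is determined
  by its coefficients at the remaining, standard monomials, and the socle has as a basis the standard
  monomials that leave the standard set when multiplied by any variable.  A monomial is standard iff
  its support is independent and its exponents are bounded by the weights; hence these socle
  monomials are exactly the products \<open>\<Prod>x\<in>W. x ^ c x\<close> for maximal independent sets \<open>W\<close>, of degree
  \<open>sum c W\<close>.  Every standard monomial divides a socle monomial, so the quotient is level iff all socle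
  monomials have the same degree.  It is always artinian: its variables are nilpotent, so the ideal
  of elements without constant term is the only prime ideal.
\<close>

section \<open>Polynomials and their monomials\<close>

lemma mpoly_ring_simps [simp]:
  "p \<otimes>\<^bsub>mpoly_ring V\<^esub> q = p * q"
  "p \<oplus>\<^bsub>mpoly_ring V\<^esub> q = p + q"
  "\<zero>\<^bsub>mpoly_ring V\<^esub> = 0"
  "\<one>\<^bsub>mpoly_ring V\<^esub> = 1"
  by (simp_all add: mpoly_ring_def)

definition monomials :: "'v set \<Rightarrow> ('v \<Rightarrow>\<^sub>0 nat) set" where
  "monomials V = {m. Poly_Mapping.keys m \<subseteq> V}"

lemma keys_add_nat:
  fixes m n :: "'v \<Rightarrow>\<^sub>0 nat"
  shows "Poly_Mapping.keys (m + n) = Poly_Mapping.keys m \<union> Poly_Mapping.keys n"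
  by (auto simp: in_keys_iff lookup_add)

lemma monomials_add [simp]: "m + n \<in> monomials V \<longleftrightarrow> m \<in> monomials V \<and> n \<in> monomials V"
  by (auto simp: monomials_def keys_add_nat)

lemma zero_in_monomials [simp]: "0 \<in> monomials V"
  by (simp add: monomials_def)

lemma single_in_monomials: "x \<in> V \<Longrightarrow> Poly_Mapping.single x k \<in> monomials V"
  by (simp add: monomials_def)

lemma carrier_mpoly_ring:
  "p \<in> carrier (mpoly_ring V) \<longleftrightarrow> Poly_Mapping.keys p \<subseteq> monomials V"
  by (auto simp: mpoly_ring_def monomials_def)

lemma keys_mult_subset:
  fixes p q :: "('v, 'k::field) mpoly"
  assumes "Poly_Mapping.keys p \<subseteq> A" and "Poly_Mapping.keys q \<subseteq> B"
  shows "Poly_Mapping.keys (p * q) \<subseteq> {a + b | a b. a \<in> A \<and> b \<in> B}"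
  using keys_mult[of p q] assms by fastforce

lemma keys_uminus [simp]:
  fixes p :: "'a \<Rightarrow>\<^sub>0 'b::ab_group_add"
  shows "Poly_Mapping.keys (- p) = Poly_Mapping.keys p"
  by (auto simp: in_keys_iff)

lemma keys_diff_subset:
  fixes p q :: "'a \<Rightarrow>\<^sub>0 'b::ab_group_add"
  shows "Poly_Mapping.keys (p - q) \<subseteq> Poly_Mapping.keys p \<union> Poly_Mapping.keys q"
  by (auto simp: in_keys_iff lookup_minus)

lemma mpoly_mult_closed:
  fixes p q :: "('v, 'k::field) mpoly"
  assumes "p \<in> carrier (mpoly_ring V)" and "q \<in> carrier (mpoly_ring V)"
  shows "p * q \<in> carrier (mpoly_ring V)"
  using keys_mult_subset[of p "monomials V" q "monomials V"] assms
  by (auto simp: carrier_mpoly_ring)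

lemma mpoly_add_closed:
  "p \<in> carrier (mpoly_ring V) \<Longrightarrow> q \<in> carrier (mpoly_ring V) \<Longrightarrow> p + q \<in> carrier (mpoly_ring V)"
  using keys_add[of p q] by (auto simp: carrier_mpoly_ring)

lemma mpoly_diff_closed:
  "p \<in> carrier (mpoly_ring V) \<Longrightarrow> q \<in> carrier (mpoly_ring V) \<Longrightarrow> p - q \<in> carrier (mpoly_ring V)"
  using keys_diff_subset[of p q] by (auto simp: carrier_mpoly_ring)

lemma single_closed: "m \<in> monomials V \<Longrightarrow> Poly_Mapping.single m a \<in> carrier (mpoly_ring V)"
  by (simp add: carrier_mpoly_ring)

lemma const_closed: "const a \<in> carrier (mpoly_ring V)"
  by (simp add: const_def single_closed)

lemma var_closed: "x \<in> V \<Longrightarrow> var x \<in> carrier (mpoly_ring V)"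
  by (simp add: var_def single_closed single_in_monomials)

lemma cring_mpoly_ring: "cring (mpoly_ring V :: ('v, 'k::field) mpoly ring)"
proof (rule cringI)
  show "abelian_group (mpoly_ring V :: ('v, 'k) mpoly ring)"
  proof (rule abelian_groupI)
    fix p :: "('v, 'k) mpoly"
    assume "p \<in> carrier (mpoly_ring V)"
    then have "- p \<in> carrier (mpoly_ring V)" by (simp add: carrier_mpoly_ring)
    then show "\<exists>q\<in>carrier (mpoly_ring V). q \<oplus>\<^bsub>mpoly_ring V\<^esub> p = \<zero>\<^bsub>mpoly_ring V\<^esub>"
      by (intro bexI[of _ "- p"]) auto
  qed (auto simp: mpoly_add_closed algebra_simps carrier_mpoly_ring[of 0])
  show "Group.comm_monoid (mpoly_ring V :: ('v, 'k) mpoly ring)"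
    by (rule comm_monoidI)
      (auto simp: mpoly_mult_closed algebra_simps carrier_mpoly_ring[of 1])
qed (auto simp: algebra_simps)

text \<open>No terms cancel: shifting exponents by \<open>n\<close> is injective and
  \<open>a\<close> is a nonzero element of a field. \<open>keys_mult\<close> gives only one
  inclusion, while the socle computation needs both.\<close>

lemma keys_mult_single:
  fixes p :: "('v, 'k::field) mpoly"
  assumes "a \<noteq> 0"
  shows "Poly_Mapping.keys (p * Poly_Mapping.single n a) = (\<lambda>m. m + n) ` Poly_Mapping.keys p"
proof
  show "Poly_Mapping.keys (p * Poly_Mapping.single n a) \<subseteq> (\<lambda>m. m + n) ` Poly_Mapping.keys p"
    using keys_mult[of p "Poly_Mapping.single n a"] assms by auto
  have "Poly_Mapping.lookup (Poly_Mapping.single n a * p) (n + m) = a * Poly_Mapping.lookup p m" for m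
    by (simp add: lookup_mult lookup_single when_mult)
  then have "Poly_Mapping.lookup (p * Poly_Mapping.single n a) (m + n) = a * Poly_Mapping.lookup p m" for m
    by (simp add: mult.commute add.commute)
  with assms show "(\<lambda>m. m + n) ` Poly_Mapping.keys p \<subseteq> Poly_Mapping.keys (p * Poly_Mapping.single n a)"
    by (auto simp: in_keys_iff)
qed

lemma poly_eq_sum_single: "p = (\<Sum>m\<in>Poly_Mapping.keys p. Poly_Mapping.single m (Poly_Mapping.lookup p m))"
  by (rule poly_mapping_eqI) (auto simp: lookup_sum lookup_single when_def in_keys_iff)

text \<open>A polynomial is the finite sum of its terms, so membership can be tested term by term.
  This is applied to a generated ideal and to the preimage of a prime ideal.\<close>

lemma in_ideal_if_terms:
  assumes I: "ideal I (mpoly_ring V)"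
    and terms: "\<And>m. m \<in> Poly_Mapping.keys p \<Longrightarrow> Poly_Mapping.single m (Poly_Mapping.lookup p m) \<in> I"
  shows "p \<in> I"
proof -
  interpret ideal I "mpoly_ring V" by fact
  have "(\<Sum>m\<in>A. Poly_Mapping.single m (Poly_Mapping.lookup p m)) \<in> I"
    if "finite A" "A \<subseteq> Poly_Mapping.keys p" for A
    using that
  proof induction
    case empty
    then show ?case using additive_subgroup.zero_closed[OF is_additive_subgroup] by simp
  next
    case (insert m A)
    then show ?case using additive_subgroup.a_closed[OF is_additive_subgroup terms[of m]] by auto
  qed
  then show ?thesis
    by (subst poly_eq_sum_single) auto
qed

text \<open>Serves two purposes: over a set of monomials closed under multiples it is a monomial
  ideal, and over a finite set of standard monomials it is a space of representatives.\<close>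

definition supported_on :: "'a set \<Rightarrow> ('a \<Rightarrow>\<^sub>0 'b::zero) set" where
  "supported_on T = {p. Poly_Mapping.keys p \<subseteq> T}"

lemma ideal_supported_on:
  assumes sub: "B \<subseteq> monomials V"
    and up: "\<And>m n. m \<in> B \<Longrightarrow> n \<in> monomials V \<Longrightarrow> m + n \<in> B"
  shows "ideal (supported_on B) (mpoly_ring V :: ('v, 'k::field) mpoly ring)"
proof -
  interpret cring "mpoly_ring V :: ('v, 'k) mpoly ring" by (rule cring_mpoly_ring)
  have minus: "\<ominus>\<^bsub>mpoly_ring V\<^esub> p = - p" if "p \<in> carrier (mpoly_ring V)" for p :: "('v, 'k) mpoly"
    using that by (intro minus_equality) (auto simp: carrier_mpoly_ring)
  have carr: "p \<in> carrier (mpoly_ring V)" if "p \<in> supported_on B" for p :: "('v, 'k) mpoly"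
    using that sub by (auto simp: supported_on_def carrier_mpoly_ring)
  have mult: "p * q \<in> supported_on B"
    if "p \<in> supported_on B" "q \<in> carrier (mpoly_ring V)" for p q :: "('v, 'k) mpoly"
    using keys_mult_subset[of p B q "monomials V"] that up
    by (auto simp: supported_on_def carrier_mpoly_ring)
  show ?thesis
  proof (rule idealI)
    show "ring (mpoly_ring V :: ('v, 'k) mpoly ring)" by (rule ring_axioms)
    show "subgroup (supported_on B) (add_monoid (mpoly_ring V :: ('v, 'k) mpoly ring))"
    proof (rule add.subgroupI)
      show "supported_on B \<subseteq> carrier (mpoly_ring V :: ('v, 'k) mpoly ring)"
        using carr by blast
      have "0 \<in> supported_on B" by (simp add: supported_on_def)
      then show "supported_on B \<noteq> {}" by blast
    next
      fix p :: "('v, 'k) mpoly" assume "p \<in> supported_on B"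
      then show "\<ominus>\<^bsub>mpoly_ring V\<^esub> p \<in> supported_on B"
        using minus[OF carr] by (simp add: supported_on_def)
    next
      fix p q :: "('v, 'k) mpoly" assume "p \<in> supported_on B" "q \<in> supported_on B"
      then show "p \<oplus>\<^bsub>mpoly_ring V\<^esub> q \<in> supported_on B"
        using keys_add[of p q] by (auto simp: supported_on_def)
    qed
  qed (use mult in \<open>auto simp: mult.commute\<close>)
qed

section \<open>Monomial ideals\<close>

definition multiples :: "'v set \<Rightarrow> ('v \<Rightarrow>\<^sub>0 nat) set \<Rightarrow> ('v \<Rightarrow>\<^sub>0 nat) set" where
  "multiples V T = {t + n | t n. t \<in> T \<and> n \<in> monomials V}"

lemma multiples_add:
  "m \<in> multiples V T \<Longrightarrow> n \<in> monomials V \<Longrightarrow> m + n \<in> multiples V T"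
  unfolding multiples_def by (fastforce simp: add.assoc)

lemma multiples_subset: "T \<subseteq> monomials V \<Longrightarrow> multiples V T \<subseteq> monomials V"
  by (auto simp: multiples_def)

lemma subset_multiples: "T \<subseteq> multiples V T"
  unfolding multiples_def by (force intro: exI[of _ 0])

text \<open>Divisibility of monomials is pointwise comparison of exponents.\<close>

lemma in_multiples_iff:
  assumes "T \<subseteq> monomials V"
  shows "m \<in> multiples V T \<longleftrightarrow>
    m \<in> monomials V \<and> (\<exists>t\<in>T. \<forall>x. Poly_Mapping.lookup t x \<le> Poly_Mapping.lookup m x)"
proof
  assume "m \<in> multiples V T"
  then obtain t n where "m = t + n" "t \<in> T" "n \<in> monomials V"
    by (auto simp: multiples_def)
  with assms show "m \<in> monomials V \<and> (\<exists>t\<in>T. \<forall>x. Poly_Mapping.lookup t x \<le> Poly_Mapping.lookup m x)"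
    by (auto simp: lookup_add intro!: bexI[of _ t])
next
  assume m: "m \<in> monomials V \<and> (\<exists>t\<in>T. \<forall>x. Poly_Mapping.lookup t x \<le> Poly_Mapping.lookup m x)"
  then obtain t where t: "t \<in> T" "\<And>x. Poly_Mapping.lookup t x \<le> Poly_Mapping.lookup m x" by blast
  \<comment> \<open>Subtraction is truncated, so this equation rests on the pointwise bound on
    \<open>t\<close>.\<close>
  then have eq: "m = t + (m - t)"
    by (intro poly_mapping_eqI) (simp add: lookup_add lookup_minus)
  moreover have "m - t \<in> monomials V"
    using m by (subst (asm) eq) simp
  ultimately show "m \<in> multiples V T"
    using t(1) unfolding multiples_def by blast
qed

text \<open>The right side is an ideal by \<open>multiples_add\<close> and contains the generators.
  Conversely, each term of one of its members is a generator times a monomial with a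
  coefficient.\<close>

lemma genideal_monomials:
  assumes "T \<subseteq> monomials V"
  shows "Idl\<^bsub>mpoly_ring V\<^esub> ((\<lambda>m. Poly_Mapping.single m 1) ` T) =
    (supported_on (multiples V T) :: ('v, 'k::field) mpoly set)"
    (is "Idl\<^bsub>_\<^esub> ?S = ?J")
proof -
  interpret cring "mpoly_ring V :: ('v, 'k) mpoly ring" by (rule cring_mpoly_ring)
  have S: "?S \<subseteq> carrier (mpoly_ring V)"
    using assms by (auto intro: single_closed)
  interpret I: ideal "Idl\<^bsub>mpoly_ring V\<^esub> ?S" "mpoly_ring V"
    using S by (rule genideal_ideal)
  show ?thesis
  proof
    have "ideal ?J (mpoly_ring V)"
      using multiples_subset[OF assms] multiples_add by (rule ideal_supported_on)
    moreover have "?S \<subseteq> ?J"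
      using subset_multiples[of T V] by (auto simp: supported_on_def)
    ultimately show "Idl\<^bsub>mpoly_ring V\<^esub> ?S \<subseteq> ?J"
      by (rule genideal_minimal)
    show "?J \<subseteq> Idl\<^bsub>mpoly_ring V\<^esub> ?S"
    proof
      fix p :: "('v, 'k) mpoly" assume p: "p \<in> ?J"
      show "p \<in> Idl\<^bsub>mpoly_ring V\<^esub> ?S"
      proof (rule in_ideal_if_terms[OF I.is_ideal])
        fix m assume "m \<in> Poly_Mapping.keys p"
        with p obtain t n where m: "m = t + n" and t: "t \<in> T" and n: "n \<in> monomials V"
          by (auto simp: supported_on_def multiples_def)
        have "Poly_Mapping.single t 1 \<in> Idl\<^bsub>mpoly_ring V\<^esub> ?S"
          using genideal_self[OF S] t by blast
        from I.I_r_closed[OF this single_closed[OF n, of "Poly_Mapping.lookup p m"]]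
        show "Poly_Mapping.single m (Poly_Mapping.lookup p m) \<in> Idl\<^bsub>mpoly_ring V\<^esub> ?S"
          by (simp add: mult_single m)
      qed
    qed
  qed
qed

text \<open>Turns the sum of the edge ideal and the ideal of powers into a single ideal generated by
  monomials.\<close>

lemma (in ring) set_add_genideal:
  assumes "S \<subseteq> carrier R" and "T \<subseteq> carrier R"
  shows "Idl S <+> Idl T = Idl (S \<union> T)"
proof
  have ST: "S \<union> T \<subseteq> carrier R" using assms by blast
  have "Idl S \<union> Idl T \<subseteq> Idl (S \<union> T)"
    using subset_Idl_subset[OF ST] by blast
  then show "Idl S <+> Idl T \<subseteq> Idl (S \<union> T)"
    using union_genideal[OF genideal_ideal genideal_ideal] genideal_minimal[OF genideal_ideal[OF ST]] assms
    by metis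
  have id: "ideal (Idl S <+> Idl T) R"
    using assms by (intro add_ideals genideal_ideal)
  have "Idl S \<union> Idl T \<subseteq> carrier R"
    using ideal.Icarr[OF genideal_ideal[OF assms(1)]] ideal.Icarr[OF genideal_ideal[OF assms(2)]]
    by blast
  then have "Idl S \<union> Idl T \<subseteq> Idl S <+> Idl T"
    using union_genideal[OF genideal_ideal[OF assms(1)] genideal_ideal[OF assms(2)]] genideal_self
    by metis
  then have "S \<union> T \<subseteq> Idl S <+> Idl T"
    using genideal_self assms by blast
  then show "Idl (S \<union> T) \<subseteq> Idl S <+> Idl T"
    by (rule genideal_minimal[OF id])
qed

text \<open>\<open>B\<close> is its own set of multiples, so its monomials generate the ideal, and
  single monomials are homogeneous.\<close>

lemma homogeneous_ideal_supported_on: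
  assumes sub: "B \<subseteq> monomials V"
    and up: "\<And>m n. m \<in> B \<Longrightarrow> n \<in> monomials V \<Longrightarrow> m + n \<in> B"
  shows "homogeneous_ideal V (supported_on B :: ('v, 'k::field) mpoly set)"
proof -
  have "multiples V B = B"
    using up subset_multiples[of B V] by (auto simp: multiples_def)
  then have "supported_on B = Idl\<^bsub>mpoly_ring V\<^esub>
      ((\<lambda>m. Poly_Mapping.single m 1 :: ('v, 'k) mpoly) ` B)"
    using genideal_monomials[OF sub, where 'k = 'k] by simp
  moreover have "(\<lambda>m. Poly_Mapping.single m 1 :: ('v, 'k) mpoly) ` B \<subseteq> (\<Union>d. homogeneous V d)"
    using sub by (auto simp: homogeneous_def intro!: single_closed)
  ultimately show ?thesis unfolding homogeneous_ideal_def by blast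
qed

lemma var_power: "(var x :: ('v, 'k::field) mpoly) ^ n = Poly_Mapping.single (Poly_Mapping.single x n) 1"
  by (induction n) (simp_all add: var_def mult_single flip: single_add)

lemma add_eq_zero_nat_iff:
  fixes m n :: "'a \<Rightarrow>\<^sub>0 nat"
  shows "m + n = 0 \<longleftrightarrow> m = 0 \<and> n = 0"
  by (metis Un_empty keys_add_nat keys_zero add_0 poly_mapping_eqI not_in_keys_iff_lookup_eq_zero empty_iff lookup_zero)

text \<open>Exponents are natural numbers, so the monomial 1 arises as a product only as 1 times 1.
  Multiplicativity of the constant term later makes the irrelevant ideal prime.\<close>

lemma lookup_mult_zero:
  fixes p q :: "('v, 'k::field) mpoly"
  shows "Poly_Mapping.lookup (p * q) 0 = Poly_Mapping.lookup p 0 * Poly_Mapping.lookup q 0"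
proof -
  have "(Poly_Mapping.lookup q n when 0 = m + n) =
      ((Poly_Mapping.lookup q n when n = 0) when m = 0)" for m n
    using add_eq_zero_nat_iff[of m n] by (auto simp: when_def)
  then show ?thesis
    by (simp add: lookup_mult Sum_any_when_independent mult_when)
qed

definition socle_monomials :: "'v set \<Rightarrow> ('v \<Rightarrow>\<^sub>0 nat) set \<Rightarrow> ('v \<Rightarrow>\<^sub>0 nat) set" where
  "socle_monomials V B = {m \<in> monomials V - B. \<forall>x\<in>V. m + Poly_Mapping.single x 1 \<in> B}"

section \<open>Quotients by monomial ideals\<close>

text \<open>\<open>B\<close> collects the monomials of the ideal; its complement in
  \<open>monomials V\<close> consists of the standard monomials. The assumption
  \<open>0 \<notin> B\<close> makes the ideal proper.\<close>

locale monomial_quotient =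
  fixes V :: "'v set" and B :: "('v \<Rightarrow>\<^sub>0 nat) set" and I :: "('v, 'k::field) mpoly set"
  defines "I \<equiv> supported_on B"
  assumes B_subset: "B \<subseteq> monomials V"
    and B_add: "m \<in> B \<Longrightarrow> n \<in> monomials V \<Longrightarrow> m + n \<in> B"
    and zero_notin_B: "0 \<notin> B"
begin

abbreviation R :: "('v, 'k) mpoly ring" where "R \<equiv> mpoly_ring V"
abbreviation A :: "('v, 'k) mpoly set ring" where "A \<equiv> quotient_algebra V I"
abbreviation res :: "('v, 'k) mpoly \<Rightarrow> ('v, 'k) mpoly set" where "res \<equiv> residue_class V I"

section \<open>Residue classes, the socle and the graded parts\<close>

lemma ideal_I: "ideal I R"
  unfolding I_def using B_subset B_add by (rule ideal_supported_on)

sublocale R: cring R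
  by (rule cring_mpoly_ring)

sublocale A: cring A
  unfolding quotient_algebra_def
  by (rule ideal.quotient_is_cring[OF ideal_I cring_mpoly_ring])

sublocale res: ring_hom_ring R A res
  using ideal.rcos_ring_hom_ring[OF ideal_I]
  by (simp add: quotient_algebra_def residue_class_def[abs_def])

text \<open>Cosets of \<open>I\<close> are translates in the additive group of all polynomials, so
  two of them agree iff the difference of representatives is supported on \<open>B\<close>.
  Coefficients off \<open>B\<close> are thus invariants of a class.\<close>

lemma res_eq_iff:
  "res p = res q \<longleftrightarrow> (\<forall>m. m \<notin> B \<longrightarrow> Poly_Mapping.lookup p m = Poly_Mapping.lookup q m)"
proof -
  have res: "res p = (\<lambda>i. i + p) ` I" for p :: "('v, 'k) mpoly"
    by (auto simp: residue_class_def a_r_coset_def')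
  have add: "i + j \<in> I" if "i \<in> I" "j \<in> I" for i j
    using that keys_add[of i j] by (auto simp: I_def supported_on_def)
  have neg: "- i \<in> I" if "i \<in> I" for i
    using that by (auto simp: I_def supported_on_def)
  have sub: "res p \<subseteq> res q" if "p - q \<in> I" for p q
  proof
    fix r assume "r \<in> res p"
    then obtain i where "i \<in> I" "r = i + p" by (auto simp: res)
    then have "i + (p - q) \<in> I" "r = (i + (p - q)) + q" using that by (auto intro: add)
    then show "r \<in> res q" unfolding res by blast
  qed
  have "res p = res q \<longleftrightarrow> p - q \<in> I"
  proof
    assume "res p = res q"
    moreover have "0 + p \<in> res p" unfolding res by (rule imageI) (simp add: I_def supported_on_def)
    ultimately obtain i where "i \<in> I" "p = i + q" by (auto simp: res)
    then show "p - q \<in> I" by simp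
  next
    assume "p - q \<in> I"
    then show "res p = res q" using sub[of p q] sub[of q p] neg[of "p - q"] by auto
  qed
  also have "\<dots> \<longleftrightarrow> (\<forall>m. m \<notin> B \<longrightarrow> Poly_Mapping.lookup p m = Poly_Mapping.lookup q m)"
    by (auto simp: I_def supported_on_def in_keys_iff lookup_minus subset_iff)
  finally show ?thesis .
qed

lemma A_zero: "\<zero>\<^bsub>A\<^esub> = res 0"
  using res.hom_zero by simp

lemma A_one: "\<one>\<^bsub>A\<^esub> = res 1"
  using res.hom_one by simp

lemma A_one_not_zero: "\<one>\<^bsub>A\<^esub> \<noteq> \<zero>\<^bsub>A\<^esub>"
  using zero_notin_B by (auto simp: A_zero A_one res_eq_iff intro!: exI[of _ 0])

lemma carrier_A: "carrier A = res ` carrier R"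
  by (auto simp: quotient_algebra_def FactRing_def A_RCOSETS_def' residue_class_def)

lemma res_eq_zero_iff: "res p = \<zero>\<^bsub>A\<^esub> \<longleftrightarrow> Poly_Mapping.keys p \<subseteq> B"
  by (auto simp: A_zero res_eq_iff in_keys_iff subset_iff)

lemma res_mult: "p \<in> carrier R \<Longrightarrow> q \<in> carrier R \<Longrightarrow> res p \<otimes>\<^bsub>A\<^esub> res q = res (p * q)"
  using res.hom_mult[of p q] by simp

lemma res_add: "p \<in> carrier R \<Longrightarrow> q \<in> carrier R \<Longrightarrow> res p \<oplus>\<^bsub>A\<^esub> res q = res (p + q)"
  using res.hom_add[of p q] by simp

text \<open>The normal form: the only representative of the class of \<open>p\<close> with no
  monomial in \<open>B\<close>.\<close>

definition restrict_off_B :: "('v, 'k) mpoly \<Rightarrow> ('v, 'k) mpoly" where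
  "restrict_off_B p = (\<Sum>m\<in>Poly_Mapping.keys p - B. Poly_Mapping.single m (Poly_Mapping.lookup p m))"

lemma lookup_restrict_off_B:
  "Poly_Mapping.lookup (restrict_off_B p) m = (if m \<in> B then 0 else Poly_Mapping.lookup p m)"
  by (auto simp: restrict_off_B_def lookup_sum lookup_single when_def in_keys_iff)

lemma keys_restrict_off_B: "Poly_Mapping.keys (restrict_off_B p) = Poly_Mapping.keys p - B"
  by (auto simp: in_keys_iff lookup_restrict_off_B split: if_splits)

lemma res_restrict_off_B: "res (restrict_off_B p) = res p"
  by (simp add: res_eq_iff lookup_restrict_off_B)

lemma res_in_socle_iff:
  assumes "p \<in> carrier R"
  shows "res p \<in> socle V I \<longleftrightarrow> Poly_Mapping.keys p \<subseteq> socle_monomials V B \<union> B"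
proof -
  have "res p \<otimes>\<^bsub>A\<^esub> res (var x) = \<zero>\<^bsub>A\<^esub> \<longleftrightarrow>
      (\<forall>m\<in>Poly_Mapping.keys p. m + Poly_Mapping.single x 1 \<in> B)" if "x \<in> V" for x
    unfolding res_mult[OF assms var_closed[OF that]] res_eq_zero_iff
    by (auto simp: var_def keys_mult_single)
  then have "res p \<in> socle V I \<longleftrightarrow>
      (\<forall>m\<in>Poly_Mapping.keys p. \<forall>x\<in>V. m + Poly_Mapping.single x 1 \<in> B)"
    using assms by (auto simp: socle_def)
  also have "\<dots> \<longleftrightarrow> Poly_Mapping.keys p \<subseteq> socle_monomials V B \<union> B"
    using assms B_add[OF _ single_in_monomials]
    by (auto simp: socle_monomials_def carrier_mpoly_ring simp del: One_nat_def)
  finally show ?thesis .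
qed

text \<open>Passing to the normal form keeps class and degree and removes the monomials of
  \<open>B\<close>; those left are socle monomials. Spaces of the resulting shape have their
  dimension computed below.\<close>

lemma socle_graded_part:
  "socle V I \<inter> graded_part V I d =
    res ` supported_on {m \<in> socle_monomials V B. mon_degree m = d}" (is "_ = res ` ?P")
proof
  show "socle V I \<inter> graded_part V I d \<subseteq> res ` ?P"
  proof
    fix X assume X: "X \<in> socle V I \<inter> graded_part V I d"
    then obtain p where p: "p \<in> homogeneous V d" "X = res p"
      by (auto simp: graded_part_def)
    with X have "Poly_Mapping.keys p \<subseteq> socle_monomials V B \<union> B"
      by (simp add: res_in_socle_iff homogeneous_def)
    with p have "restrict_off_B p \<in> ?P"
      by (auto simp: supported_on_def keys_restrict_off_B homogeneous_def)
    then show "X \<in> res ` ?P"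
      unfolding p(2) by (subst res_restrict_off_B[symmetric]) (rule imageI)
  qed
  show "res ` ?P \<subseteq> socle V I \<inter> graded_part V I d"
  proof (rule image_subsetI)
    fix p assume p: "p \<in> ?P"
    then have "p \<in> carrier R"
      by (auto simp: supported_on_def carrier_mpoly_ring socle_monomials_def)
    with p show "res p \<in> socle V I \<inter> graded_part V I d"
      by (auto simp: res_in_socle_iff graded_part_def supported_on_def homogeneous_def)
  qed
qed

lemma graded_part_nonzero_iff:
  "graded_part V I d \<noteq> {\<zero>\<^bsub>A\<^esub>} \<longleftrightarrow> (\<exists>m\<in>monomials V - B. mon_degree m = d)"
proof -
  \<comment> \<open>Zero lies in every graded part, so differing from the zero space means
    containing a nonzero class.\<close>
  have "(0 :: ('v, 'k) mpoly) \<in> homogeneous V d"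
    by (simp add: homogeneous_def carrier_mpoly_ring)
  then have "graded_part V I d \<noteq> {\<zero>\<^bsub>A\<^esub>} \<longleftrightarrow> (\<exists>p\<in>homogeneous V d. res p \<noteq> \<zero>\<^bsub>A\<^esub>)"
    unfolding graded_part_def by blast
  also have "\<dots> \<longleftrightarrow> (\<exists>m\<in>monomials V - B. mon_degree m = d)"
  proof
    assume "\<exists>p\<in>homogeneous V d. res p \<noteq> \<zero>\<^bsub>A\<^esub>"
    then obtain p :: "('v, 'k) mpoly" where "p \<in> homogeneous V d" "\<not> Poly_Mapping.keys p \<subseteq> B"
      unfolding res_eq_zero_iff by blast
    then show "\<exists>m\<in>monomials V - B. mon_degree m = d"
      by (fastforce simp: homogeneous_def carrier_mpoly_ring)
  next
    assume "\<exists>m\<in>monomials V - B. mon_degree m = d"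
    then obtain m where m: "m \<in> monomials V" "m \<notin> B" "mon_degree m = d" by blast
    show "\<exists>p\<in>homogeneous V d. res p \<noteq> \<zero>\<^bsub>A\<^esub>"
      using m by (intro bexI[of _ "Poly_Mapping.single m 1"])
        (auto simp: res_eq_zero_iff homogeneous_def single_closed)
  qed
  finally show ?thesis .
qed

section \<open>Dimension over the scalars, counted by standard monomials\<close>

lemma subfield_range_const: "subfield (range const) R"
proof (rule R.subfieldI)
  have const_mult: "const a * const b = (const (a * b) :: ('v, 'k) mpoly)" for a b
    by (simp add: const_def mult_single)
  have one: "(1 :: ('v, 'k) mpoly) = const 1"
    by (simp add: const_def)
  have zero: "(0 :: ('v, 'k) mpoly) = const 0"
    by (simp add: const_def)
  have const_eq_iff: "const a = (const b :: ('v, 'k) mpoly) \<longleftrightarrow> a = b" for a b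
    by (auto simp: const_def dest: injD[OF inj_single])
  have minus: "\<ominus>\<^bsub>R\<^esub> const a = const (- a)" for a
    by (rule R.minus_equality) (auto simp: const_def single_closed simp flip: single_add)
  show "subcring (range const) R"
  proof (rule R.subcringI')
    show "subring (range const) R"
    proof (rule R.subringI)
      fix p q :: "('v, 'k) mpoly" assume "p \<in> range const" "q \<in> range const"
      then show "p \<otimes>\<^bsub>R\<^esub> q \<in> range const" "p \<oplus>\<^bsub>R\<^esub> q \<in> range const"
        by (auto simp: const_mult) (auto simp: const_def simp flip: single_add)
    qed (auto simp: const_closed one minus)
  qed
  show "Units (R\<lparr>carrier := range const\<rparr>) = range const - {\<zero>\<^bsub>R\<^esub>}"
  proof -
    have "(\<exists>b. b * a = 1 \<and> a * b = 1) \<longleftrightarrow> a \<noteq> 0" for a :: 'k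
      by (auto intro: exI[of _ "inverse a"])
    then show ?thesis
      by (auto simp: Units_def const_mult one zero const_eq_iff mpoly_ring_def)
  qed
qed

lemma scalars_eq: "scalars V I = res ` range const"
  by (auto simp: scalars_def)

text \<open>Dimensions are taken over a subfield. The image of a subfield under the residue map is
  again one because the quotient is nonzero.\<close>

lemma subfield_scalars: "subfield (scalars V I) A"
  unfolding scalars_eq by (rule res.img_is_subfield(2)[OF subfield_range_const A_one_not_zero])

text \<open>Classes of standard monomials are linearly independent, since a coefficient off
  \<open>B\<close> depends only on the class. Each new monomial therefore extends the span by one
  line, which matches the inductive definition of \<open>dimension\<close>.\<close>

lemma dimension_res_supported_on:
  assumes "finite F" and "F \<subseteq> monomials V - B"
  shows "A.dimension (card F) (scalars V I) (res ` supported_on F)"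
  using assms
proof induction
  case empty
  have "(supported_on {} :: ('v, 'k) mpoly set) = {0}"
    by (auto simp: supported_on_def in_keys_iff intro!: poly_mapping_eqI)
  then show ?case using A.zero_dim by (simp add: A_zero)
next
  case (insert m F)
  let ?K = "scalars V I" and ?v = "res (Poly_Mapping.single m 1)"
  have m: "m \<in> monomials V" "m \<notin> B" using insert.prems by auto
  have carr: "p \<in> carrier R" if "p \<in> supported_on F" for p
    using that insert.prems by (auto simp: supported_on_def carrier_mpoly_ring)
  have "?v \<notin> res ` supported_on F"
  proof
    assume "?v \<in> res ` supported_on F"
    then obtain p where p: "p \<in> supported_on F" "?v = res p" by auto
    then have "Poly_Mapping.lookup p m = 0"
      using insert.hyps by (auto simp: supported_on_def simp flip: not_in_keys_iff_lookup_eq_zero)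
    moreover have "Poly_Mapping.lookup p m = 1"
      using p m by (auto simp: res_eq_iff)
    ultimately show False by simp
  qed
  then have "A.dimension (Suc (card F)) ?K (A.line_extension ?K ?v (res ` supported_on F))"
    using insert m by (intro A.Suc_dim res.hom_closed single_closed) auto
  moreover have "A.line_extension ?K ?v (res ` supported_on F) = res ` supported_on (insert m F)"
  proof -
    have "A.line_extension ?K ?v (res ` supported_on F) =
        {res (Poly_Mapping.single m a + p) | a p. p \<in> supported_on F}"
    proof -
      have "res (const a) \<otimes>\<^bsub>A\<^esub> ?v \<oplus>\<^bsub>A\<^esub> res p = res (Poly_Mapping.single m a + p)"
        if "p \<in> supported_on F" for a p
        using carr[OF that] m
        by (simp add: res_mult res_add const_closed single_closed mpoly_mult_closed)
          (simp add: const_def mult_single)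
      then show ?thesis
        unfolding A.line_extension_def set_add_def' r_coset_def scalars_def by (simp add: image_def) blast
    qed
    also have "\<dots> = res ` supported_on (insert m F)"
    proof
      show "{res (Poly_Mapping.single m a + p) | a p. p \<in> supported_on F} \<subseteq> res ` supported_on (insert m F)"
        using keys_add by (fastforce simp: supported_on_def split: if_splits)
      show "res ` supported_on (insert m F) \<subseteq> {res (Poly_Mapping.single m a + p) | a p. p \<in> supported_on F}"
      proof (rule image_subsetI)
        fix p :: "('v, 'k) mpoly" assume "p \<in> supported_on (insert m F)"
        \<comment> \<open>Splitting off the term at \<open>m\<close> leaves a polynomial supported
          on \<open>F\<close>.\<close>
        then have "p - Poly_Mapping.single m (Poly_Mapping.lookup p m) \<in> supported_on F"
          by (auto simp: supported_on_def in_keys_iff lookup_minus lookup_single when_def split: if_splits)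
        then show "res p \<in> {res (Poly_Mapping.single m a + p) | a p. p \<in> supported_on F}"
          by (intro CollectI exI[of _ "Poly_Mapping.lookup p m"]
              exI[of _ "p - Poly_Mapping.single m (Poly_Mapping.lookup p m)"]) simp
      qed
    qed
    finally show ?thesis .
  qed
  ultimately show ?case using insert.hyps by simp
qed

lemma socle_vector_eq:
  assumes "finite (monomials V - B)"
  shows "socle_vector V I d = card {m \<in> socle_monomials V B. mon_degree m = d}"
  unfolding socle_vector_def socle_graded_part
  using assms
  by (intro A.dimI[OF subfield_scalars] dimension_res_supported_on)
    (auto simp: socle_monomials_def intro: finite_subset)

section \<open>Prime ideals and Krull dimension\<close>

definition irrelevant_ideal :: "('v, 'k) mpoly set set" where
  "irrelevant_ideal = res ` supported_on (monomials V - {0})"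

lemma ideal_positive: "ideal (supported_on (monomials V - {0})) R"
  by (rule ideal_supported_on) (auto simp: add_eq_zero_nat_iff)

text \<open>The constant term is well defined on classes because
  \<open>0 \<notin> B\<close>.\<close>

lemma res_in_irrelevant_ideal_iff:
  assumes "p \<in> carrier R"
  shows "res p \<in> irrelevant_ideal \<longleftrightarrow> Poly_Mapping.lookup p 0 = 0"
proof
  assume "res p \<in> irrelevant_ideal"
  then obtain q where q: "q \<in> supported_on (monomials V - {0})" "res p = res q"
    by (auto simp: irrelevant_ideal_def)
  then have "Poly_Mapping.lookup p 0 = Poly_Mapping.lookup q 0"
    using zero_notin_B by (auto simp: res_eq_iff)
  also have "\<dots> = 0"
    using q by (auto simp: supported_on_def simp flip: not_in_keys_iff_lookup_eq_zero)
  finally show "Poly_Mapping.lookup p 0 = 0" .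
next
  assume "Poly_Mapping.lookup p 0 = 0"
  then show "res p \<in> irrelevant_ideal"
    using assms unfolding irrelevant_ideal_def
    by (intro imageI) (auto simp: supported_on_def carrier_mpoly_ring in_keys_iff)
qed

text \<open>Constant terms multiply inside a field, which has no zero divisors; the class of 1 lies
  outside, so the ideal is proper.\<close>

lemma primeideal_irrelevant_ideal: "primeideal irrelevant_ideal A"
proof (rule primeidealI)
  show "ideal irrelevant_ideal A"
    using R.ring_ideal_imp_quot_ideal[OF ideal_I ideal_positive]
    by (simp add: irrelevant_ideal_def quotient_algebra_def residue_class_def[abs_def])
  show "cring A" by (rule A.is_cring)
  have one: "(1 :: ('v, 'k) mpoly) \<in> carrier R" using R.one_closed by simp
  then have "res 1 \<notin> irrelevant_ideal" by (simp add: res_in_irrelevant_ideal_iff)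
  then show "carrier A \<noteq> irrelevant_ideal" using one carrier_A by blast
next
  fix X Y assume "X \<in> carrier A" "Y \<in> carrier A" and XY: "X \<otimes>\<^bsub>A\<^esub> Y \<in> irrelevant_ideal"
  then obtain p q where "p \<in> carrier R" "X = res p" "q \<in> carrier R" "Y = res q"
    unfolding carrier_A by blast
  with XY show "X \<in> irrelevant_ideal \<or> Y \<in> irrelevant_ideal"
    by (simp add: res_mult res_in_irrelevant_ideal_iff mpoly_mult_closed lookup_mult_zero)
qed

text \<open>A prime ideal contains the nilpotent variables, hence every class without constant term.
  An element with nonzero constant term would then put a unit into it.\<close>

lemma primeideal_A_eq:
  assumes nilpotent: "\<And>x. x \<in> V \<Longrightarrow> \<exists>n. Poly_Mapping.single x n \<in> B"
    and "primeideal P A"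
  shows "P = irrelevant_ideal"
proof -
  interpret P: primeideal P A by fact
  have var_in_P: "res (var x) \<in> P" if x: "x \<in> V" for x
  proof -
    obtain n where n: "Poly_Mapping.single x n \<in> B" using nilpotent[OF x] by blast
    have carr: "var x ^ k \<in> carrier R" for k
      unfolding var_power using x by (intro single_closed single_in_monomials)
    have "res (var x ^ n) = \<zero>\<^bsub>A\<^esub>"
      using n by (simp add: var_power res_eq_zero_iff)
    then have "res (var x ^ n) \<in> P"
      using additive_subgroup.zero_closed[OF P.is_additive_subgroup] by simp
    \<comment> \<open>Primality strips off one factor of the power at a time; at exponent 0 the
      ideal would contain 1.\<close>
    then show "res (var x) \<in> P"
    proof (induction n)
      case 0
      then show ?case
        using P.one_imp_carrier P.I_notcarr by (simp add: A_one)
    next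
      case (Suc n)
      have "res (var x) \<otimes>\<^bsub>A\<^esub> res (var x ^ n) \<in> P"
        using Suc.prems carr[of n] by (simp add: res_mult var_closed x)
      then show ?case
        using P.I_prime Suc.IH carr[of n] var_closed[OF x] carrier_A by blast
    qed
  qed
  \<comment> \<open>The preimage in the polynomial ring allows arguing term by term.\<close>
  define J where "J = {p \<in> carrier R. res p \<in> P}"
  have J: "ideal J R"
    unfolding J_def by (rule res.ideal_vimage) (rule P.is_ideal)
  have positive: "supported_on (monomials V - {0}) \<subseteq> J"
  proof
    fix p :: "('v, 'k) mpoly" assume p: "p \<in> supported_on (monomials V - {0})"
    show "p \<in> J"
    proof (rule in_ideal_if_terms[OF J])
      fix m assume "m \<in> Poly_Mapping.keys p"
      with p have m: "m \<in> monomials V" "m \<noteq> 0" by (auto simp: supported_on_def)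
      then obtain x where x: "x \<in> Poly_Mapping.keys m"
        by (metis poly_mapping_eqI not_in_keys_iff_lookup_eq_zero lookup_zero)
      \<comment> \<open>A variable \<open>x\<close> occurring in \<open>m\<close> is split off;
        truncated subtraction is exact here since its exponent is positive.\<close>
      define n where "n = m - Poly_Mapping.single x 1"
      have n: "m = Poly_Mapping.single x 1 + n"
        using x by (intro poly_mapping_eqI) (auto simp: n_def lookup_add lookup_minus lookup_single when_def in_keys_iff)
      have "x \<in> V" "n \<in> monomials V"
        using m x unfolding n by (auto simp: monomials_def keys_add_nat)
      moreover have "var x \<in> J"
        using var_in_P var_closed \<open>x \<in> V\<close> by (simp add: J_def)
      ultimately have "var x * Poly_Mapping.single n (Poly_Mapping.lookup p m) \<in> J"
        using ideal.I_r_closed[OF J, of "var x"] by (simp add: single_closed)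
      then show "Poly_Mapping.single m (Poly_Mapping.lookup p m) \<in> J"
        by (simp add: var_def mult_single n[symmetric] del: One_nat_def)
    qed
  qed
  then have le: "irrelevant_ideal \<subseteq> P"
    by (auto simp: irrelevant_ideal_def J_def)
  have "P \<subseteq> irrelevant_ideal"
  proof
    fix X assume X: "X \<in> P"
    then obtain p where p: "p \<in> carrier R" "X = res p"
      using P.Icarr carrier_A by blast
    define a where "a = Poly_Mapping.lookup p 0"
    have "p - const a \<in> carrier R"
      using p(1) const_closed by (rule mpoly_diff_closed)
    moreover have "Poly_Mapping.lookup (p - const a) 0 = 0"
      by (simp add: a_def const_def lookup_minus)
    ultimately have pos: "p - const a \<in> J"
      using le res_in_irrelevant_ideal_iff[of "p - const a"] by (auto simp: J_def)
    interpret J: ideal J R by (rule J)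
    have "a = 0"
    proof (rule ccontr)
      assume "a \<noteq> 0"
      have "p \<in> J" using X p unfolding J_def by blast
      \<comment> \<open>Subtracting from \<open>p\<close> its part without constant term isolates
        \<open>a\<close>. Negation is written as multiplication by the constant -1, so that
        absorption by the ideal applies.\<close>
      moreover have "(p - const a) * const (- 1) \<in> J"
        using J.I_r_closed[OF pos const_closed] unfolding mpoly_ring_simps .
      ultimately have "p + (p - const a) * const (- 1) \<in> J"
        by (rule additive_subgroup.a_closed[OF J.is_additive_subgroup, unfolded mpoly_ring_simps])
      moreover have "p + (p - const a) * const (- 1) = const a"
        by (simp add: const_def single_uminus)
      ultimately have "const a \<in> J" by simp
      then have "const a * const (inverse a) \<in> J"
        by (rule J.I_r_closed[OF _ const_closed, unfolded mpoly_ring_simps])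
      then have "res (const a * const (inverse a)) \<in> P"
        unfolding J_def by blast
      then have "res 1 \<in> P"
        using \<open>a \<noteq> 0\<close> by (simp add: const_def mult_single)
      then show False
        using P.one_imp_carrier P.I_notcarr by (simp add: A_one)
    qed
    then show "X \<in> irrelevant_ideal"
      using p by (simp add: res_in_irrelevant_ideal_iff a_def)
  qed
  with le show ?thesis by blast
qed

text \<open>The irrelevant ideal is the only prime ideal, so every chain has length 0.\<close>

lemma krull_dim_A:
  assumes "\<And>x. x \<in> V \<Longrightarrow> \<exists>n. Poly_Mapping.single x n \<in> B"
  shows "krull_dim A = 0"
proof -
  have "(\<exists>P. prime_chain A P k) \<longleftrightarrow> k = 0" for k
  proof
    assume "\<exists>P. prime_chain A P k"
    then obtain P where P: "prime_chain A P k" ..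
    show "k = 0"
    proof (rule ccontr)
      assume "k \<noteq> 0"
      with P have "primeideal (P 0) A" "primeideal (P 1) A" "P 0 \<subset> P 1"
        by (auto simp: prime_chain_def)
      then show False using primeideal_A_eq[OF assms] by blast
    qed
  next
    \<comment> \<open>The existence of a prime ideal matters: with no chain at all the supremum
      would be minus infinity.\<close>
    assume "k = 0"
    then show "\<exists>P. prime_chain A P k"
      using primeideal_irrelevant_ideal by (auto simp: prime_chain_def)
  qed
  then have "{ereal (real k) | k. \<exists>P. prime_chain A P k} = {0}"
    by (auto simp: zero_ereal_def)
  then show ?thesis by (simp add: krull_dim_def)
qed

text \<open>Nilpotent variables make the quotient artinian. \<open>socle_above\<close> bounds the
  degree of any standard monomial by that of a socle monomial, so a common socle degree is also the
  top degree of the algebra.\<close>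

lemma level_graded_artinian_iff:
  assumes nilpotent: "\<And>x. x \<in> V \<Longrightarrow> \<exists>n. Poly_Mapping.single x n \<in> B"
    and finite: "finite (monomials V - B)"
    and socle_above: "\<And>m. m \<in> monomials V - B \<Longrightarrow>
      \<exists>s\<in>socle_monomials V B. mon_degree m \<le> mon_degree s"
  shows "level_graded_artinian V I \<longleftrightarrow> (\<exists>e. \<forall>s\<in>socle_monomials V B. mon_degree s = e)"
proof -
  have artinian: "graded_artinian V I"
    using krull_dim_A[OF nilpotent] homogeneous_ideal_supported_on[OF B_subset B_add]
    by (simp add: graded_artinian_def I_def)
  have fin: "finite {m \<in> socle_monomials V B. mon_degree m = d}" for d
    using finite by (rule rev_finite_subset) (auto simp: socle_monomials_def)
  have socle: "socle_vector V I d = 0 \<longleftrightarrow> (\<forall>s\<in>socle_monomials V B. mon_degree s \<noteq> d)" for d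
    using fin by (auto simp: socle_vector_eq[OF finite])
  have socle_B: "s \<in> monomials V - B" if "s \<in> socle_monomials V B" for s
    using that by (simp add: socle_monomials_def)
  show ?thesis
  proof
    assume "level_graded_artinian V I"
    then obtain e where
      "\<forall>d>e. graded_part V I d = {\<zero>\<^bsub>A\<^esub>}" "\<forall>d<e. socle_vector V I d = 0"
      by (auto simp: level_graded_artinian_def)
    \<comment> \<open>Socle monomials are standard, so degrees above \<open>e\<close> are excluded
      by the vanishing graded parts and degrees below \<open>e\<close> by the vanishing socle
      vector.\<close>
    then have "\<forall>s\<in>socle_monomials V B. mon_degree s = e"
      using graded_part_nonzero_iff socle socle_B by (metis linorder_neqE_nat)
    then show "\<exists>e. \<forall>s\<in>socle_monomials V B. mon_degree s = e" ..
  next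
    assume "\<exists>e. \<forall>s\<in>socle_monomials V B. mon_degree s = e"
    then obtain e where e: "\<And>s. s \<in> socle_monomials V B \<Longrightarrow> mon_degree s = e" by blast
    \<comment> \<open>Applied to the monomial 1, \<open>socle_above\<close> yields a socle monomial,
      so the condition on degrees is not vacuous.\<close>
    obtain s where s: "s \<in> socle_monomials V B"
      using socle_above[of 0] zero_notin_B by auto
    have "graded_part V I e \<noteq> {\<zero>\<^bsub>A\<^esub>}"
      by (intro iffD2[OF graded_part_nonzero_iff] bexI[of _ s] e s socle_B)
    moreover have "graded_part V I d = {\<zero>\<^bsub>A\<^esub>}" if "d > e" for d
    proof (rule ccontr)
      assume "graded_part V I d \<noteq> {\<zero>\<^bsub>A\<^esub>}"
      then obtain m where m: "m \<in> monomials V - B" "mon_degree m = d"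
        using iffD1[OF graded_part_nonzero_iff] by blast
      obtain t where "t \<in> socle_monomials V B" "mon_degree m \<le> mon_degree t"
        using socle_above[OF m(1)] by blast
      with m e[of t] that show False by simp
    qed
    moreover have "socle_vector V I d = 0" if "d < e" for d
      using socle e that by auto
    moreover have "socle_vector V I e > 0"
      using socle[of e] e s by auto
    ultimately show "level_graded_artinian V I"
      using artinian unfolding level_graded_artinian_def by blast
  qed
qed

end

section \<open>The ideal of a weighted graph\<close>

lemma mon_degree_superset:
  assumes "finite V" and "m \<in> monomials V"
  shows "mon_degree m = (\<Sum>x\<in>V. Poly_Mapping.lookup m x)"
  unfolding mon_degree_def using assms
  by (intro sum.mono_neutral_left) (auto simp: monomials_def in_keys_iff)

lemma finite_bounded_monomials:
  assumes "finite V"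
  shows "finite {m \<in> monomials V. \<forall>x\<in>V. Poly_Mapping.lookup m x \<le> (c x :: nat)}" (is "finite ?M")
proof -
  \<comment> \<open>\<open>sum c V\<close> bounds all weights at once, as
    \<open>finite_set_of_finite_funs\<close> takes a single codomain.\<close>
  let ?F = "{f. \<forall>x. (x \<in> V \<longrightarrow> f x \<in> {..sum c V}) \<and> (x \<notin> V \<longrightarrow> f x = 0)}"
  have "Poly_Mapping.lookup m \<in> ?F" if "m \<in> ?M" for m
  proof -
    have "Poly_Mapping.lookup m x \<le> sum c V" if "x \<in> V" for x
      using \<open>m \<in> ?M\<close> that member_le_sum[OF that _ assms, of c] by force
    moreover have "Poly_Mapping.lookup m x = 0" if "x \<notin> V" for x
      using \<open>m \<in> ?M\<close> that by (auto simp: monomials_def in_keys_iff)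
    ultimately show ?thesis by simp
  qed
  then have "Poly_Mapping.lookup ` ?M \<subseteq> ?F" by (rule image_subsetI)
  moreover have "finite ?F"
    using assms by (intro finite_set_of_finite_funs) auto
  ultimately have "finite (Poly_Mapping.lookup ` ?M)"
    by (rule finite_subset)
  then show ?thesis
    by (rule finite_imageD) (auto intro!: inj_onI simp: poly_mapping.lookup_inject)
qed

lemma ex_MaxInd_superset:
  assumes "finite V" and "independent_set V E W"
  shows "\<exists>W'\<in>MaxInd V E. W \<subseteq> W'"
proof -
  let ?S = "{U. independent_set V E U \<and> W \<subseteq> U}"
  have "finite ?S"
    by (rule finite_subset[of _ "Pow V"]) (use assms(1) in \<open>auto simp: independent_set_def\<close>)
  moreover have "?S \<noteq> {}" using assms(2) by blast
  ultimately have "\<exists>U\<in>?S. \<forall>U'\<in>?S. U \<subseteq> U' \<longrightarrow> U = U'"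
    by (rule finite_has_maximal)
  then obtain U where U: "independent_set V E U" "W \<subseteq> U"
      "\<forall>U'\<in>?S. U \<subseteq> U' \<longrightarrow> U = U'"
    by blast
  \<comment> \<open>Any independent set containing \<open>U\<close> also contains \<open>W\<close>
    and so belongs to \<open>?S\<close>.\<close>
  then have "U \<in> MaxInd V E"
    unfolding MaxInd_def by blast
  with U(2) show ?thesis by blast
qed

locale weighted_graph =
  fixes V :: "'v set" and E :: "'v set set" and c :: "'v \<Rightarrow> nat"
  assumes graph: "simple_graph V E" and c_pos: "x \<in> V \<Longrightarrow> c x > 0"
begin

lemma finite_V: "finite V"
  using graph by (simp add: simple_graph_def)

lemma edge_subset: "e \<in> E \<Longrightarrow> e \<subseteq> V"
  using graph by (simp add: simple_graph_def)

section \<open>The monomials of the ideal and its generators\<close>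

definition edge_monomials :: "('v \<Rightarrow>\<^sub>0 nat) set" where
  "edge_monomials = {Poly_Mapping.single x 1 + Poly_Mapping.single y 1 | x y. {x, y} \<in> E}"

definition power_monomials :: "('v \<Rightarrow>\<^sub>0 nat) set" where
  "power_monomials = (\<lambda>x. Poly_Mapping.single x (c x + 1)) ` V"

text \<open>Phrased by support and exponents instead of divisibility by generators, so that the
  complement reads as independent support with exponents bounded by the weights.\<close>

definition ideal_monomials :: "('v \<Rightarrow>\<^sub>0 nat) set" where
  "ideal_monomials = {m \<in> monomials V.
    (\<exists>e\<in>E. e \<subseteq> Poly_Mapping.keys m) \<or> (\<exists>x\<in>V. c x < Poly_Mapping.lookup m x)}"

lemma edge_monomials_subset: "edge_monomials \<subseteq> monomials V"
  using edge_subset by (fastforce simp: edge_monomials_def monomials_def keys_add_nat)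

lemma power_monomials_subset: "power_monomials \<subseteq> monomials V"
  by (auto simp: power_monomials_def monomials_def)

text \<open>A monomial is divisible by the product of an edge iff both ends lie in its support, and
  by \<open>x ^ (c x + 1)\<close> iff its exponent at \<open>x\<close> exceeds
  \<open>c x\<close>.\<close>

lemma multiples_generators:
  "multiples V (edge_monomials \<union> power_monomials) = ideal_monomials"
proof -
  have edge: "(\<exists>t\<in>edge_monomials. \<forall>x. Poly_Mapping.lookup t x \<le> Poly_Mapping.lookup m x) \<longleftrightarrow>
      (\<exists>e\<in>E. e \<subseteq> Poly_Mapping.keys m)" for m
  proof
    assume "\<exists>t\<in>edge_monomials. \<forall>x. Poly_Mapping.lookup t x \<le> Poly_Mapping.lookup m x"
    then obtain x y where xy: "{x, y} \<in> E"
      "\<And>z. Poly_Mapping.lookup (Poly_Mapping.single x 1 + Poly_Mapping.single y (1::nat)) z \<le>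
        Poly_Mapping.lookup m z"
      by (auto simp: edge_monomials_def)
    have "{x, y} \<subseteq> Poly_Mapping.keys m"
      using xy(2)[of x] xy(2)[of y] by (auto simp: lookup_add in_keys_iff)
    with xy(1) show "\<exists>e\<in>E. e \<subseteq> Poly_Mapping.keys m" by blast
  next
    assume "\<exists>e\<in>E. e \<subseteq> Poly_Mapping.keys m"
    then obtain e where e: "e \<in> E" "e \<subseteq> Poly_Mapping.keys m" by blast
    then have "card e = 2" using graph by (simp add: simple_graph_def)
    then obtain x y where xy: "e = {x, y}" "x \<noteq> y" by (auto simp: card_2_iff)
    \<comment> \<open>The ends of an edge are distinct, so exponent at least 1 at each of them
      suffices for divisibility.\<close>
    have "Poly_Mapping.lookup (Poly_Mapping.single x 1 + Poly_Mapping.single y 1) z \<le>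
        Poly_Mapping.lookup m z" for z
      using e xy by (auto simp: lookup_add lookup_single when_def in_keys_iff)
    with e xy show "\<exists>t\<in>edge_monomials. \<forall>x. Poly_Mapping.lookup t x \<le> Poly_Mapping.lookup m x"
      unfolding edge_monomials_def by blast
  qed
  have power: "(\<exists>t\<in>power_monomials. \<forall>x. Poly_Mapping.lookup t x \<le> Poly_Mapping.lookup m x) \<longleftrightarrow>
      (\<exists>x\<in>V. c x < Poly_Mapping.lookup m x)" for m
    by (auto simp: power_monomials_def lookup_single when_def Suc_le_eq)
  have "edge_monomials \<union> power_monomials \<subseteq> monomials V"
    using edge_monomials_subset power_monomials_subset by blast
  from in_multiples_iff[OF this] show ?thesis
    by (auto simp: bex_Un edge power ideal_monomials_def)
qed

text \<open>Both families of generators consist of monomials, so the sum is the monomial ideal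
  generated by their union. This brings the ideal of the theorem into the form of
  \<open>monomial_quotient\<close>.\<close>

lemma ideal_eq_supported_on:
  "edge_ideal V E <+>\<^bsub>mpoly_ring V\<^esub>
    Idl\<^bsub>mpoly_ring V\<^esub> ((\<lambda>x. var x ^ (c x + 1)) ` V) =
    (supported_on ideal_monomials :: ('v, 'k::field) mpoly set)"
proof -
  let ?s = "\<lambda>m. Poly_Mapping.single m 1 :: ('v, 'k) mpoly"
  interpret cring "mpoly_ring V :: ('v, 'k) mpoly ring" by (rule cring_mpoly_ring)
  have "{var x * var y | x y. {x, y} \<in> E} = ?s ` edge_monomials"
    by (auto simp: edge_monomials_def var_def mult_single)
  moreover have "(\<lambda>x. var x ^ (c x + 1)) ` V = ?s ` power_monomials"
    by (simp add: power_monomials_def var_power image_image del: power_Suc)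
  moreover have "?s ` edge_monomials \<subseteq> carrier (mpoly_ring V)" "?s ` power_monomials \<subseteq> carrier (mpoly_ring V)"
    using edge_monomials_subset power_monomials_subset by (auto intro: single_closed)
  ultimately have "edge_ideal V E <+>\<^bsub>mpoly_ring V\<^esub> Idl\<^bsub>mpoly_ring V\<^esub> ((\<lambda>x. var x ^ (c x + 1)) ` V) =
      Idl\<^bsub>mpoly_ring V\<^esub> (?s ` (edge_monomials \<union> power_monomials))"
    unfolding edge_ideal_def by (simp add: set_add_genideal image_Un)
  also have "\<dots> = supported_on ideal_monomials"
    using edge_monomials_subset power_monomials_subset
    by (subst genideal_monomials) (auto simp: multiples_generators)
  finally show ?thesis .
qed

section \<open>Socle monomials of the graph ideal\<close>

definition weight_monomial :: "'v set \<Rightarrow> 'v \<Rightarrow>\<^sub>0 nat" where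
  "weight_monomial W = (\<Sum>x\<in>W. Poly_Mapping.single x (c x))"

lemma lookup_weight_monomial:
  assumes "W \<subseteq> V"
  shows "Poly_Mapping.lookup (weight_monomial W) x = (if x \<in> W then c x else 0)"
  using finite_subset[OF assms finite_V]
  by (auto simp: weight_monomial_def lookup_sum lookup_single when_def)

text \<open>Positivity of the weights enters here: weight 0 would remove a vertex from the
  support.\<close>

lemma keys_weight_monomial: "W \<subseteq> V \<Longrightarrow> Poly_Mapping.keys (weight_monomial W) = W"
  by (auto simp: in_keys_iff lookup_weight_monomial subset_iff c_pos split: if_splits)

lemma mon_degree_weight_monomial: "W \<subseteq> V \<Longrightarrow> mon_degree (weight_monomial W) = sum c W"
  by (simp add: mon_degree_def keys_weight_monomial lookup_weight_monomial)

lemma not_ideal_monomial_iff: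
  "m \<in> monomials V - ideal_monomials \<longleftrightarrow>
    independent_set V E (Poly_Mapping.keys m) \<and> (\<forall>x\<in>V. Poly_Mapping.lookup m x \<le> c x)"
  by (auto simp: ideal_monomials_def independent_set_def monomials_def not_less)

lemma monomial_quotient: "monomial_quotient V ideal_monomials"
proof
  show "ideal_monomials \<subseteq> monomials V" by (auto simp: ideal_monomials_def)
  show "m + n \<in> ideal_monomials" if "m \<in> ideal_monomials" "n \<in> monomials V" for m n
    using that by (auto simp: ideal_monomials_def keys_add_nat lookup_add intro: trans_less_add1)
  \<comment> \<open>Edges have two elements; an empty edge would be contained in the support of the
    monomial 1.\<close>
  have "{} \<notin> E"
    using graph by (auto simp: simple_graph_def)
  then show "0 \<notin> ideal_monomials"
    by (auto simp: ideal_monomials_def)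
qed

text \<open>Let a standard monomial have support \<open>W\<close>. Multiplying by \<open>x\<close>
  in \<open>W\<close> keeps the support, so it leaves the standard set iff the exponent of
  \<open>x\<close> is already \<open>c x\<close>. Multiplying by \<open>x\<close> outside
  \<open>W\<close> gives exponent 1, within the positive bound, so it leaves iff
  \<open>insert x W\<close> contains an edge. The latter for all such \<open>x\<close> is maximality
  of \<open>W\<close>.\<close>

lemma socle_monomials_eq: "socle_monomials V ideal_monomials = weight_monomial ` MaxInd V E"
proof
  show "socle_monomials V ideal_monomials \<subseteq> weight_monomial ` MaxInd V E"
  proof
    fix m assume "m \<in> socle_monomials V ideal_monomials"
    then have m: "m \<in> monomials V - ideal_monomials"
      and "\<forall>x\<in>V. m + Poly_Mapping.single x 1 \<in> ideal_monomials"
      by (auto simp: socle_monomials_def)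
    then have bad: "(\<exists>e\<in>E. e \<subseteq> insert x (Poly_Mapping.keys m)) \<or>
        (\<exists>y\<in>V. c y < Poly_Mapping.lookup m y + (if x = y then 1 else 0))" if "x \<in> V" for x
      using that by (auto simp: ideal_monomials_def keys_add_nat lookup_add lookup_single when_def
          split: if_splits)
    define W where "W = Poly_Mapping.keys m"
    have W: "independent_set V E W" and le: "\<And>x. x \<in> V \<Longrightarrow> Poly_Mapping.lookup m x \<le> c x"
      using m unfolding not_ideal_monomial_iff W_def by auto
    then have "W \<subseteq> V" by (simp add: independent_set_def)
    have "Poly_Mapping.lookup m x = (if x \<in> W then c x else 0)" for x
    proof (cases "x \<in> W")
      case True
      then have "x \<in> V" "insert x W = W" using \<open>W \<subseteq> V\<close> by auto
      \<comment> \<open>The support stays independent, which rules out the edge alternative of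
        \<open>bad\<close>.\<close>
      then have "\<exists>y\<in>V. c y < Poly_Mapping.lookup m y + (if x = y then 1 else 0)"
        using bad[of x] W unfolding W_def[symmetric] by (auto simp: independent_set_def)
      \<comment> \<open>The bound can fail only at \<open>y = x\<close>, as all exponents of
        \<open>m\<close> respect it.\<close>
      then have "c x < Poly_Mapping.lookup m x + 1"
        using le by (auto simp: not_less split: if_splits dest: leD)
      with True le[OF \<open>x \<in> V\<close>] show ?thesis by simp
    qed (simp add: W_def in_keys_iff)
    then have "m = weight_monomial W"
      by (intro poly_mapping_eqI) (simp add: lookup_weight_monomial[OF \<open>W \<subseteq> V\<close>])
    moreover have "W \<in> MaxInd V E"
      unfolding MaxInd_def
    proof (intro CollectI conjI allI impI notI)
      show "independent_set V E W" by (rule W)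
      fix W' assume W': "independent_set V E W'" and "W \<subset> W'"
      then obtain x where x: "x \<in> W'" "x \<notin> W" by blast
      then have "x \<in> V" using W' by (auto simp: independent_set_def)
      \<comment> \<open>The exponent of \<open>x\<close> rises from 0 to 1, which is at most
        \<open>c x\<close>; the other exponents are unchanged.\<close>
      have "\<not> c y < Poly_Mapping.lookup m y + (if x = y then 1 else 0)" if "y \<in> V" for y
        using le[OF that] c_pos[OF that] x(2) by (auto simp: W_def in_keys_iff)
      then obtain e where "e \<in> E" "e \<subseteq> insert x W"
        using bad[OF \<open>x \<in> V\<close>] unfolding W_def by blast
      then show False
        using W' x(1) \<open>W \<subset> W'\<close> unfolding independent_set_def by blast
    qed
    ultimately show "m \<in> weight_monomial ` MaxInd V E" by blast
  qed
  show "weight_monomial ` MaxInd V E \<subseteq> socle_monomials V ideal_monomials"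
  proof (rule image_subsetI)
    fix W assume W: "W \<in> MaxInd V E"
    then have ind: "independent_set V E W" and "W \<subseteq> V"
      by (auto simp: MaxInd_def independent_set_def)
    let ?m = "weight_monomial W"
    have m: "?m \<in> monomials V - ideal_monomials"
      unfolding not_ideal_monomial_iff
      using ind \<open>W \<subseteq> V\<close> by (simp add: keys_weight_monomial lookup_weight_monomial)
    have "?m + Poly_Mapping.single x 1 \<in> ideal_monomials" if "x \<in> V" for x
    proof (cases "x \<in> W")
      case True
      then have "c x < Poly_Mapping.lookup (?m + Poly_Mapping.single x 1) x"
        using \<open>W \<subseteq> V\<close> by (simp add: lookup_add lookup_weight_monomial)
      with m that show ?thesis
        by (auto simp: ideal_monomials_def single_in_monomials)
    next
      case False
      then have "\<not> independent_set V E (insert x W)"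
        using W unfolding MaxInd_def by blast
      then obtain e where "e \<in> E" "e \<subseteq> insert x W"
        using \<open>x \<in> V\<close> \<open>W \<subseteq> V\<close> by (auto simp: independent_set_def)
      with m that show ?thesis
        by (auto simp: ideal_monomials_def single_in_monomials keys_add_nat
            keys_weight_monomial[OF \<open>W \<subseteq> V\<close>])
    qed
    with m show "?m \<in> socle_monomials V ideal_monomials"
      by (simp add: socle_monomials_def)
  qed
qed

text \<open>The support extends to a maximal independent set \<open>W\<close>, and \<open>m\<close>
  divides the monomial of \<open>weight_monomial W\<close> because its exponents are at most the
  weights.\<close>

lemma mon_degree_le_socle:
  assumes "m \<in> monomials V - ideal_monomials"
  shows "\<exists>s\<in>socle_monomials V ideal_monomials. mon_degree m \<le> mon_degree s"
proof -
  from assms obtain W where W: "W \<in> MaxInd V E" "Poly_Mapping.keys m \<subseteq> W"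
    using ex_MaxInd_superset[OF finite_V] unfolding not_ideal_monomial_iff by blast
  then have "W \<subseteq> V" by (auto simp: MaxInd_def independent_set_def)
  have "mon_degree m = (\<Sum>x\<in>W. Poly_Mapping.lookup m x)"
    using W(2) \<open>W \<subseteq> V\<close> finite_V
    by (intro mon_degree_superset) (auto simp: monomials_def intro: finite_subset)
  also have "\<dots> \<le> sum c W"
    using assms \<open>W \<subseteq> V\<close> unfolding not_ideal_monomial_iff by (intro sum_mono) auto
  also have "\<dots> = mon_degree (weight_monomial W)"
    using \<open>W \<subseteq> V\<close> by (simp add: mon_degree_weight_monomial)
  finally show ?thesis
    using W(1) by (auto simp: socle_monomials_eq)
qed

lemma finite_standard_monomials: "finite (monomials V - ideal_monomials)"
  by (rule finite_subset[OF _ finite_bounded_monomials[OF finite_V, of c]])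
    (auto simp: ideal_monomials_def not_less)

text \<open>Supplies the nilpotency of the variables from which Krull dimension 0 follows.\<close>

lemma single_in_ideal_monomials: "x \<in> V \<Longrightarrow> Poly_Mapping.single x (c x + 1) \<in> ideal_monomials"
  by (auto simp: ideal_monomials_def single_in_monomials intro!: bexI[of _ x])

lemma levelable_iff_level:
  "levelable V E c \<longleftrightarrow>
    level_graded_artinian V (supported_on ideal_monomials :: ('v, 'k::field) mpoly set)"
proof -
  have "level_graded_artinian V (supported_on ideal_monomials :: ('v, 'k) mpoly set) \<longleftrightarrow>
      (\<exists>e. \<forall>s\<in>socle_monomials V ideal_monomials. mon_degree s = e)"
    using monomial_quotient.level_graded_artinian_iff[OF monomial_quotient _
        finite_standard_monomials mon_degree_le_socle] single_in_ideal_monomials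
    by blast
  also have "\<dots> \<longleftrightarrow> (\<exists>e. \<forall>W\<in>MaxInd V E. mon_degree (weight_monomial W) = e)"
    by (simp add: socle_monomials_eq)
  also have "\<dots> \<longleftrightarrow> levelable V E c"
    unfolding levelable_def
    by (intro arg_cong[where f = Ex] ext ball_cong refl)
      (simp add: mon_degree_weight_monomial MaxInd_def independent_set_def)
  finally show ?thesis by simp
qed

end

theorem theorem1p2:
  fixes V :: "'v set" and E :: "'v set set" and c :: "'v \<Rightarrow> nat"
  assumes "simple_graph V E" and "\<And>x. x \<in> V \<Longrightarrow> c x > 0"
  shows "levelable V E c \<longleftrightarrow>
    level_graded_artinian V
      (edge_ideal V E <+>\<^bsub>mpoly_ring V\<^esub>
        Idl\<^bsub>mpoly_ring V\<^esub> ((\<lambda>x. var x ^ (c x + 1)) ` V) :: ('v, 'k::field) mpoly set)"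
proof -
  interpret weighted_graph V E c
    using assms by unfold_locales
  show ?thesis
    unfolding ideal_eq_supported_on by (rule levelable_iff_level)
qed

end
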